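(* Let $1\le n\le p$ be integers, let $X\in\mathbb{R}^{n\times p}$ be a matrix of full rank $n$, let $\beta^\star\in\mathbb{R}^p$, $\varepsilon\in\mathbb{R}^n$, $y=X\beta^\star+\varepsilon$, and let $\lambda_n^0\in\mathbb{R}$ be such that $\|X^\top\varepsilon\|_{\ell_\infty}\le\lambda_n^0$. (i) Assume that $X$ satisfies $\mathrm{UDP}(S_0,\kappa_0,\Delta)$, where $1\le S_0\le p$ and $0<\kappa_0<1/4$. Let $\lambda_d>0$ satisfy $\lambda_d>\lambda_n^0/(1-4\kappa_0)$, and let $\beta^d$ be a Dantzig selector with parameter $\lambda_d$. Then $$\|X\beta^d-X\beta^\star\|_{\ell_2}\le\min_{\mathcal S}\Bigg[4\lambda_d\,\Delta\sqrt s+\frac{\|\beta^\star_{\mathcal S^c}\|_{\ell_1}}{\Delta\sqrt s}\Bigg],$$ where the minimum is over all $\mathcal S\subseteq\{1,\dots,p\}$ with $|\mathcal S|=s$, $1\le s\le S_0$. (ii) Let $\rho_n>0$ be the smallest singular value of $X$ and $\delta$ the distortion of $\ker(X)$ (with no UDP assumption). For all $0<\kappa_0<1/4$, all $\lambda_d>0$ with $\lambda_d>\lambda_n^0/(1-4\kappa_0)$, every Dantzig selector $\beta^d$ with parameter $\lambda_d$, and every $\mathcal S\subseteq\{1,\dots,p\}$ with $|\mathcal S|=s$, $1\le s\le(\kappa_0/\delta)^2p$, $$\|X\beta^d-X\beta^\star\|_{\ell_2}\le 4\lambda_d\cdot\frac{2\,\delta}{\rho_n}\cdot\sqrt s+\frac{1}{2\delta\sqrt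 s}\cdot\rho_n\,\|\beta^\star_{\mathcal S^c}\|_{\ell_1}$$ (i.e. the bound holds with the minimum over all such $\mathcal S$ on the right-hand side).
   Context: For $x\in\mathbb{R}^m$, $\|x\|_{\ell_1}=\sum_i|x_i|$, $\|x\|_{\ell_2}=(\sum_i x_i^2)^{1/2}$, $\|x\|_{\ell_\infty}=\max_i|x_i|$. For $\gamma\in\mathbb{R}^p$ and $\mathcal S\subseteq\{1,\dots,p\}$, $\gamma_{\mathcal S}\in\mathbb{R}^p$ is the vector with $(\gamma_{\mathcal S})_i=\gamma_i$ if $i\in\mathcal S$ and $0$ otherwise; $\mathcal S^c=\{1,\dots,p\}\setminus\mathcal S$. The singular values of the rank-$n$ matrix $X$ ($n\le p$) are $\rho_1\ge\dots\ge\rho_n>0$. Dantzig selector with parameter $\lambda_d>0$: any $$\beta^d\in\arg\min_{\beta\in\mathbb{R}^p}\|\beta\|_{\ell_1}\quad\text{subject to}\quad\|X^\top(y-X\beta)\|_{\ell_\infty}\le\lambda_d.$$ Universal Distortion Property: for $1\le S_0\le p$, $0<\kappa_0<1/2$ and $\Delta>0$, $X$ satisfies $\mathrm{UDP}(S_0,\kappa_0,\Delta)$ if for all $\gamma\in\mathbb{R}^p$, all integers $s$ with $1\le s\le S_0$, and all $\mathcal S\subseteq\{1,\dots,p\}$ with $|\mathcal S|=s$, $$\|\gamma_{\mathcal S}\|_{\ell_1}\le\Delta\sqrt s\,\|X\gamma\|_{\ell_2}+\kappa_0\|\gamma\|_{\ell_1}.$$ A subspace $\Gamma\subset\mathbb{R}^p$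 has distortion $\delta$, with $1\le\delta\le\sqrt p$, if $\|x\|_{\ell_1}\le\sqrt p\,\|x\|_{\ell_2}\le\delta\,\|x\|_{\ell_1}$ for all $x\in\Gamma$. "The distortion" of $\Gamma$ is the smallest such $\delta$, i.e. $\delta=\sup_{x\in\Gamma\setminus\{0\}}\sqrt p\,\|x\|_{\ell_2}/\|x\|_{\ell_1}$ (and $\delta=1$ if $\Gamma=\{0\}$). *)

theory Defs
  imports "HOL-Analysis.Analysis"
begin

text \<open>
  Vectors in R^p and R^n are elements of \<open>real ^ 'p\<close> and \<open>real ^ 'n\<close>, a matrix with n rows and
  p columns is an element of \<open>real ^ 'p ^ 'n\<close>, and sets of column indices are of type \<open>'p set\<close>.
  The Euclidean norm is \<^const>\<open>norm\<close> and the maximum norm is \<^const>\<open>infnorm\<close>.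
\<close>

definition l1norm :: "real ^ 'p \<Rightarrow> real"
  where "l1norm x = (\<Sum>i\<in>UNIV. \<bar>x $ i\<bar>)"

definition restrict_vec :: "real ^ 'p \<Rightarrow> 'p set \<Rightarrow> real ^ 'p"
  where "restrict_vec x S = (\<chi> i. if i \<in> S then x $ i else 0)"

definition dantzig_selector ::
    "real ^ 'p ^ 'n \<Rightarrow> real ^ 'n \<Rightarrow> real \<Rightarrow> real ^ 'p \<Rightarrow> bool"
  where "dantzig_selector X y l b \<longleftrightarrow>
    is_arg_min l1norm (\<lambda>b. infnorm (transpose X *v (y - X *v b)) \<le> l) b"

definition UDP :: "real ^ 'p ^ 'n \<Rightarrow> nat \<Rightarrow> real \<Rightarrow> real \<Rightarrow> bool"
  where "UDP X S0 \<kappa>0 \<Delta> \<longleftrightarrow>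
    1 \<le> S0 \<and> S0 \<le> CARD('p) \<and> 0 < \<kappa>0 \<and> \<kappa>0 < 1/2 \<and> 0 < \<Delta> \<and>
    (\<forall>\<gamma> :: real ^ 'p. \<forall>s :: nat. \<forall>S :: 'p set. 1 \<le> s \<and> s \<le> S0 \<and> card S = s \<longrightarrow>
       l1norm (restrict_vec \<gamma> S) \<le> \<Delta> * sqrt s * norm (X *v \<gamma>) + \<kappa>0 * l1norm \<gamma>)"

definition has_distortion :: "(real ^ 'p) set \<Rightarrow> real \<Rightarrow> bool"
  where "has_distortion \<Gamma> \<delta> \<longleftrightarrow>
    subspace \<Gamma> \<and> 1 \<le> \<delta> \<and> \<delta> \<le> sqrt (CARD('p)) \<and>
    (\<forall>x\<in>\<Gamma>. l1norm x \<le> sqrt (CARD('p)) * norm x \<and>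
            sqrt (CARD('p)) * norm x \<le> \<delta> * l1norm x)"

definition distortion :: "(real ^ 'p) set \<Rightarrow> real"
  where "distortion \<Gamma> = (LEAST \<delta>. has_distortion \<Gamma> \<delta>)"

text \<open>
  A singular value comes with a pair of unit left and right singular vectors. This includes the
  value 0 only if both \<open>X\<close> and its transpose have a nontrivial kernel, so for a matrix of full
  row rank the set below consists of exactly the positive singular values.
\<close>

definition singular_values :: "real ^ 'p ^ 'n \<Rightarrow> real set"
  where "singular_values X = {\<sigma>. 0 \<le> \<sigma> \<and>
    (\<exists>u v. norm u = 1 \<and> norm v = 1 \<and> X *v v = \<sigma> *\<^sub>R u \<and> transpose X *v u = \<sigma> *\<^sub>R v)}"

definition smallest_singular_value :: "real ^ 'p ^ 'n \<Rightarrow> real"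
  where "smallest_singular_value X = Min (singular_values X)"

lemma l1norm_le_norm: "l1norm (x :: real ^ 'p) \<le> sqrt (CARD('p)) * norm x"
proof -
  have "l1norm x = (\<Sum>i\<in>UNIV. \<bar>1::real\<bar> * \<bar>x $ i\<bar>)" by (simp add: l1norm_def)
  also have "\<dots> \<le> L2_set (\<lambda>i::'p. 1) UNIV * L2_set (\<lambda>i. x $ i) UNIV"
    by (rule L2_set_mult_ineq)
  also have "\<dots> = sqrt (CARD('p)) * norm x"
    by (simp add: L2_set_def norm_vec_def)
  finally show ?thesis .
qed

lemma norm_le_l1norm: "norm x \<le> l1norm x"
  by (simp add: l1norm_def norm_le_l1_cart)

lemma distortion_eq_SUP:
  fixes \<Gamma> :: "(real ^ 'p) set"
  assumes "subspace \<Gamma>"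
  shows "distortion \<Gamma> =
    (if \<Gamma> = {0} then 1 else (SUP x\<in>\<Gamma> - {0}. sqrt (CARD('p)) * norm x / l1norm x))"
proof -
  let ?f = "\<lambda>x :: real ^ 'p. sqrt (CARD('p)) * norm x / l1norm x"
  have p1: "1 \<le> sqrt (CARD('p))" by simp
  have pos: "l1norm x > 0" if "x \<noteq> 0" for x :: "real ^ 'p"
    using norm_le_l1norm[of x] that by (meson less_le_trans zero_less_norm_iff)
  have f1: "1 \<le> ?f x" if "x \<noteq> 0" for x
    using l1norm_le_norm[of x] pos[OF that] by (simp add: field_simps)
  have f2: "?f x \<le> sqrt (CARD('p))" if "x \<noteq> 0" for x
    using norm_le_l1norm[of x] pos[OF that] by (simp add: field_simps)
  have hd: "has_distortion \<Gamma> d \<longleftrightarrow>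
      1 \<le> d \<and> d \<le> sqrt (CARD('p)) \<and> (\<forall>x\<in>\<Gamma> - {0}. ?f x \<le> d)" for d
  proof -
    have "sqrt (CARD('p)) * norm x \<le> d * l1norm x \<longleftrightarrow> (x \<noteq> 0 \<longrightarrow> ?f x \<le> d)" for x
      using pos[of x] by (cases "x = 0") (simp_all add: l1norm_def[of 0] field_simps)
    then show ?thesis
      using assms l1norm_le_norm unfolding has_distortion_def by auto
  qed
  show ?thesis
  proof (cases "\<Gamma> = {0}")
    case True
    then show ?thesis
      using p1 unfolding distortion_def hd by (auto intro!: Least_equality)
  next
    case False
    with assms obtain x0 where x0: "x0 \<in> \<Gamma> - {0}" using subspace_0 by blast
    have bdd: "bdd_above (?f ` (\<Gamma> - {0}))" using f2 by (auto intro!: bdd_aboveI2)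
    have "distortion \<Gamma> = (SUP x\<in>\<Gamma> - {0}. ?f x)"
      unfolding distortion_def
    proof (rule Least_equality)
      have "1 \<le> (SUP x\<in>\<Gamma> - {0}. ?f x)"
        using f1[of x0] x0 cSUP_upper[OF x0 bdd] by auto
      moreover have "(SUP x\<in>\<Gamma> - {0}. ?f x) \<le> sqrt (CARD('p))"
        using x0 f2 by (intro cSUP_least) auto
      ultimately show "has_distortion \<Gamma> (SUP x\<in>\<Gamma> - {0}. ?f x)"
        unfolding hd using cSUP_upper[OF _ bdd] by blast
    next
      fix d assume "has_distortion \<Gamma> d"
      then show "(SUP x\<in>\<Gamma> - {0}. ?f x) \<le> d"
        unfolding hd using x0 by (intro cSUP_least) auto
    qed
    with False show ?thesis by simp
  qed
qed

lemma singular_values_full_row_rank: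
  fixes X :: "real ^ 'p ^ 'n"
  assumes "rank X = CARD('n)"
  shows "finite (singular_values X)" "singular_values X \<noteq> {}"
    and "\<And>\<sigma>. \<sigma> \<in> singular_values X \<Longrightarrow> 0 < \<sigma>"
proof -
  let ?T = "\<lambda>u. transpose X *v u"
  have adj: "?T u \<bullet> v = u \<bullet> (X *v v)" for u v
    by (metis dot_lmul_matrix transpose_matrix_vector)
  have "inj ?T"
    using assms by (metis full_rank_injective rank_transpose)
  then have T0: "?T u = 0 \<Longrightarrow> u = 0" for u
    by (metis injD matrix_vector_mult_0_right)
  show pos: "0 < \<sigma>" if s: "\<sigma> \<in> singular_values X" for \<sigma>
  proof -
    from s obtain u v where "0 \<le> \<sigma>" "norm u = 1" "?T u = \<sigma> *\<^sub>R v"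
      unfolding singular_values_def by blast
    with T0[of u] show ?thesis by (cases "\<sigma> = 0") auto
  qed
  show "finite (singular_values X)"
  proof -
    have "\<forall>\<sigma>\<in>singular_values X. \<exists>u. norm u = 1 \<and> X *v (?T u) = \<sigma>\<^sup>2 *\<^sub>R u"
      unfolding singular_values_def
      by (force simp: matrix_vector_mult_scaleR power2_eq_square)
    then obtain U where U: "\<And>\<sigma>. \<sigma> \<in> singular_values X \<Longrightarrow>
        norm (U \<sigma>) = 1 \<and> X *v (?T (U \<sigma>)) = \<sigma>\<^sup>2 *\<^sub>R U \<sigma>" by metis
    have orth: "U a \<bullet> U b = 0" if ab: "a \<in> singular_values X" "b \<in> singular_values X" "a \<noteq> b" for a b
    proof -
      have "a\<^sup>2 * (U a \<bullet> U b) = (X *v (?T (U a))) \<bullet> U b" using U ab by simp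
      also have "\<dots> = ?T (U a) \<bullet> ?T (U b)" by (metis adj inner_commute)
      also have "\<dots> = U a \<bullet> (X *v (?T (U b)))" by (rule adj)
      also have "\<dots> = b\<^sup>2 * (U a \<bullet> U b)" using U ab by simp
      finally show ?thesis
        using pos[OF ab(1)] pos[OF ab(2)] ab(3) by (auto simp: power2_eq_iff)
    qed
    have "inj_on U (singular_values X)"
    proof (rule inj_onI)
      fix a b assume *: "a \<in> singular_values X" "b \<in> singular_values X" "U a = U b"
      then have "U a \<bullet> U b = 1" using U by (metis norm_eq_1)
      then show "a = b" using orth * by fastforce
    qed
    moreover have "finite (U ` singular_values X)"
      by (rule pairwise_orthogonal_imp_finite) (auto simp: pairwise_def orthogonal_def intro!: orth)
    ultimately show ?thesis using finite_imageD by blast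
  qed
  show "singular_values X \<noteq> {}"
  proof -
    have "compact (sphere (0 :: real ^ 'n) 1)" by simp
    moreover have "sphere (0 :: real ^ 'n) 1 \<noteq> {}" by simp
    moreover have "continuous_on (sphere 0 1) (\<lambda>u. norm (?T u))"
      by (intro continuous_intros linear_continuous_on matrix_vector_mul_bounded_linear)
    ultimately obtain u where u: "norm u = 1"
      and mn: "\<And>w. norm w = 1 \<Longrightarrow> norm (?T u) \<le> norm (?T w)"
      using continuous_attains_inf[of "sphere (0 :: real ^ 'n) 1"] by force
    define m where "m = norm (?T u)"
    have "u \<noteq> 0" using u by auto
    then have m: "0 < m" unfolding m_def using T0 by auto
    have ge: "m * norm w \<le> norm (?T w)" for w
    proof (cases "w = 0")
      case False
      then have "m \<le> norm (?T ((1 / norm w) *\<^sub>R w))"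
        unfolding m_def by (intro mn) simp
      also have "\<dots> = norm (?T w) / norm w" using False by (simp add: matrix_vector_mult_scaleR)
      finally show ?thesis using False by (simp add: field_simps)
    qed simp
    define g where "g = X *v (?T u) - m\<^sup>2 *\<^sub>R u"
    have g: "g = 0"
    proof (rule ccontr)
      assume "g \<noteq> 0"
      then have gg: "0 < g \<bullet> g" by simp
      define c where "c = ?T g \<bullet> ?T g - m\<^sup>2 * (g \<bullet> g)"
      have q: "0 \<le> ?T w \<bullet> ?T w - m\<^sup>2 * (w \<bullet> w)" for w
      proof -
        have "(m * norm w)\<^sup>2 \<le> (norm (?T w))\<^sup>2" using ge m by (intro power_mono) auto
        then show ?thesis by (simp add: power_mult_distrib power2_norm_eq_inner)
      qed
      have uu: "u \<bullet> u = 1" "?T u \<bullet> ?T u = m\<^sup>2"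
        using u by (simp_all add: m_def power2_norm_eq_inner flip: norm_eq_1)
      have ug: "?T u \<bullet> ?T g = g \<bullet> g + m\<^sup>2 * (u \<bullet> g)"
      proof -
        have "?T u \<bullet> ?T g = (X *v (?T u)) \<bullet> g" by (metis adj inner_commute)
        also have "\<dots> = (g + m\<^sup>2 *\<^sub>R u) \<bullet> g" by (simp add: g_def)
        finally show ?thesis by (simp add: inner_add_left)
      qed
      have key: "0 \<le> t\<^sup>2 * c - 2 * t * (g \<bullet> g)" for t
      proof -
        have "?T (u - t *\<^sub>R g) = ?T u - t *\<^sub>R ?T g"
          by (simp add: matrix_vector_mult_diff_distrib matrix_vector_mult_scaleR)
        then show ?thesis
          using q[of "u - t *\<^sub>R g"] uu ug
          by (simp add: inner_diff_left inner_diff_right inner_commute c_def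
              algebra_simps power2_eq_square)
      qed
      have c0: "0 \<le> c" using q[of g] by (simp add: c_def)
      define t where "t = (g \<bullet> g) / (c + 1)"
      have t: "0 < t" "t * c < g \<bullet> g + g \<bullet> g"
        using gg c0 by (simp_all add: t_def field_simps add_pos_nonneg add_nonneg_pos)
      then have "t * (t * c - 2 * (g \<bullet> g)) < 0" by (simp add: mult_pos_neg)
      then show False using key[of t] by (simp add: algebra_simps power2_eq_square)
    qed
    have "m \<in> singular_values X"
      unfolding singular_values_def
    proof (intro CollectI conjI exI[of _ u] exI[of _ "(1 / m) *\<^sub>R ?T u"])
      show "X *v ((1 / m) *\<^sub>R ?T u) = m *\<^sub>R u"
        using g m by (simp add: g_def matrix_vector_mult_scaleR power2_eq_square)
    qed (use m u in \<open>simp_all add: m_def\<close>)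
    then show ?thesis by blast
  qed
qed

end

theory Submission imports Defs begin

text \<open>
  Write \<open>h = \<beta>d - \<beta>star\<close> for the estimation error and \<open>t = norm (X *v h)\<close>. Since \<open>\<beta>star\<close> is itself
  feasible, two things hold. The residual correlations of \<open>\<beta>d\<close> and \<open>\<beta>star\<close> are both small, so
  \<open>t\<^sup>2\<close>, the pairing of \<open>h\<close> with \<open>X\<^sup>T X h\<close>, is at most \<open>(lamd + lam0) * l1norm h\<close>. And \<open>\<beta>d\<close> has
  the smaller l1 norm, which forces the mass of \<open>h\<close> off \<open>S\<close> to be controlled by its mass on \<open>S\<close>, up
  to twice the mass \<open>B\<close> of \<open>\<beta>star\<close> off \<open>S\<close>. The distortion inequality bounds the mass of \<open>h\<close> on \<open>S\<close>
  by \<open>a * t + \<kappa>0 * l1norm h\<close> with \<open>a = \<Delta> * sqrt s\<close>; as \<open>\<kappa>0 < 1/4\<close> the last term can be absorbed.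
  The threshold on \<open>lamd\<close> is exactly what turns the outcome into \<open>t\<^sup>2 \<le> 4 * lamd * (a * t + B)\<close>, and
  this quadratic inequality implies \<open>t \<le> 4 * lamd * a + B / a\<close>
  (\<open>dantzig_prediction_bound\<close>).

  Only the distortion inequality for the given \<open>S\<close> enters, so the second part follows from the same
  bound once a matrix whose kernel has distortion \<open>\<delta>\<close> is shown to satisfy it with
  \<open>\<Delta> = 2 * \<delta> / \<rho>\<close> (\<open>distortion_ineq_of_kernel_distortion\<close>). Split \<open>\<gamma>\<close> into a kernel component and
  a row space component. The former is spread out because of the distortion of the kernel, so a
  small set \<open>S\<close> sees only a fraction of its l1 norm; the latter has Euclidean norm at most
  \<open>norm (X *v \<gamma>) / \<rho>\<close>, by the variational characterisation of the smallest singular value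
  (\<open>smallest_singular_value_le\<close>).
\<close>

section \<open>The l1 norm\<close>

lemma l1norm_nonneg: "0 \<le> l1norm x"
  by (simp add: l1norm_def sum_nonneg)

lemma l1norm_diff_le: "l1norm (x - y) \<le> l1norm x + l1norm y"
  unfolding l1norm_def sum.distrib[symmetric] by (intro sum_mono) simp

lemma l1norm_restrict_vec: "l1norm (restrict_vec x S) = (\<Sum>i\<in>S. \<bar>x $ i\<bar>)"
proof -
  have "l1norm (restrict_vec x S) = (\<Sum>i\<in>UNIV. if i \<in> S then \<bar>x $ i\<bar> else 0)"
    unfolding l1norm_def restrict_vec_def by (intro sum.cong) auto
  then show ?thesis by (simp add: sum.If_cases)
qed

lemma l1norm_split: "l1norm x = l1norm (restrict_vec x S) + l1norm (restrict_vec x (- S))"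
  unfolding l1norm_restrict_vec unfolding l1norm_def
  by (subst sum.union_disjoint[symmetric]) auto

lemma l1norm_restrict_vec_le: "l1norm (restrict_vec x S) \<le> sqrt (card S) * norm x"
proof -
  have "(\<Sum>i\<in>S. \<bar>x $ i\<bar>) = (\<Sum>i\<in>S. \<bar>1::real\<bar> * \<bar>x $ i\<bar>)" by simp
  also have "\<dots> \<le> L2_set (\<lambda>i. 1) S * L2_set (\<lambda>i. x $ i) S"
    by (rule L2_set_mult_ineq)
  also have "\<dots> \<le> sqrt (card S) * L2_set (\<lambda>i. x $ i) UNIV"
    unfolding L2_set_def by (auto intro!: mult_left_mono sum_mono2)
  also have "L2_set (\<lambda>i. x $ i) UNIV = norm x"
    by (simp add: L2_set_def norm_vec_def)
  finally show ?thesis by (simp add: l1norm_restrict_vec)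
qed

lemma inner_le_l1norm_infnorm: "x \<bullet> y \<le> l1norm x * infnorm y"
proof -
  have "x \<bullet> y = (\<Sum>i\<in>UNIV. x $ i * y $ i)" by (simp add: inner_vec_def)
  also have "\<dots> \<le> (\<Sum>i\<in>UNIV. \<bar>x $ i\<bar> * infnorm y)"
  proof (rule sum_mono)
    fix i
    have "x $ i * y $ i \<le> \<bar>x $ i\<bar> * \<bar>y $ i\<bar>" by (metis abs_ge_self abs_mult)
    also have "\<dots> \<le> \<bar>x $ i\<bar> * infnorm y"
      by (intro mult_left_mono component_le_infnorm_cart) simp
    finally show "x $ i * y $ i \<le> \<bar>x $ i\<bar> * infnorm y" .
  qed
  finally show ?thesis by (simp add: l1norm_def sum_distrib_right)
qed

section \<open>Prediction error of the Dantzig selector\<close>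

lemma transpose_inner: "(transpose X *v u) \<bullet> v = u \<bullet> (X *v (v :: real ^ 'p))"
  by (metis dot_lmul_matrix transpose_matrix_vector)

text \<open>
  A competitor \<open>b\<close> with no larger l1 norm than \<open>b0\<close> can gain mass off \<open>S\<close> only by losing at least as
  much on \<open>S\<close>; the mass that \<open>b0\<close> already has off \<open>S\<close> may be cancelled and so is counted twice.
\<close>

lemma l1norm_error_le:
  assumes "l1norm b \<le> l1norm b0"
  shows "l1norm (b - b0) \<le>
    2 * l1norm (restrict_vec (b - b0) S) + 2 * l1norm (restrict_vec b0 (- S))"
proof -
  have on: "l1norm (restrict_vec b0 S) - l1norm (restrict_vec (b - b0) S) \<le> l1norm (restrict_vec b S)"
    unfolding l1norm_restrict_vec sum_subtractf[symmetric] by (intro sum_mono) auto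
  have off: "l1norm (restrict_vec (b - b0) (- S)) - l1norm (restrict_vec b0 (- S))
      \<le> l1norm (restrict_vec b (- S))"
    unfolding l1norm_restrict_vec sum_subtractf[symmetric] by (intro sum_mono) auto
  show ?thesis
    using on off assms l1norm_split[of b S] l1norm_split[of b0 S] l1norm_split[of "b - b0" S]
    by linarith
qed

text \<open>
  If \<open>t\<close> were larger, then \<open>t\<close> would be at least \<open>c * a\<close> and \<open>t - c * a\<close> larger than \<open>B / a\<close>, so
  their product would exceed \<open>(c * a) * (B / a) = c * B\<close>.
\<close>

lemma quadratic_bound:
  fixes a :: real
  assumes "0 < a" "0 \<le> B" "0 \<le> c" and q: "t\<^sup>2 \<le> c * (a * t + B)"
  shows "t \<le> c * a + B / a"
proof (rule ccontr)
  assume "\<not> ?thesis"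
  then have t: "B / a < t - c * a" by simp
  have nn: "0 \<le> B / a" "0 \<le> c * a" using assms by auto
  have "c * B = (c * a) * (B / a)" using \<open>0 < a\<close> by simp
  also have "\<dots> \<le> t * (B / a)" using t nn by (intro mult_right_mono) auto
  also have "\<dots> < t * (t - c * a)" using t nn by (intro mult_strict_left_mono) auto
  finally show False using q by (simp add: algebra_simps power2_eq_square)
qed

text \<open>
  The distortion inequality is required only for the set \<open>S\<close> and the error vector, with
  \<open>a\<close> in the role of \<open>\<Delta> * sqrt s\<close>, which covers both ways of supplying it.
\<close>

lemma dantzig_prediction_bound:
  fixes X :: "real ^ 'p ^ 'n"
  assumes y: "y = X *v b0 + \<epsilon>" and noise: "infnorm (transpose X *v \<epsilon>) \<le> lam0"
    and \<kappa>: "0 < \<kappa>" "\<kappa> < 1/4" and lam: "lam0 / (1 - 4 * \<kappa>) < lam"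
    and sel: "dantzig_selector X y lam b"
    and a: "0 < a"
    and dist: "l1norm (restrict_vec (b - b0) S) \<le> a * norm (X *v (b - b0)) + \<kappa> * l1norm (b - b0)"
  shows "norm (X *v b - X *v b0) \<le> 4 * lam * a + l1norm (restrict_vec b0 (- S)) / a"
proof -
  define h where "h = b - b0"
  define t where "t = norm (X *v h)"
  define B where "B = l1norm (restrict_vec b0 (- S))"
  have B: "0 \<le> B" by (simp add: B_def l1norm_nonneg)
  have lam0: "0 \<le> lam0" using noise infnorm_pos_le by (rule order_trans[rotated])
  have lam': "lam0 < lam * (1 - 4 * \<kappa>)" using lam \<kappa> by (simp add: field_simps)
  have "0 < lam * (1 - 4 * \<kappa>)" using lam0 lam' by linarith
  then have lam_pos: "0 < lam" using \<kappa> by (simp add: zero_less_mult_iff)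
  have "lam * (1 - 4 * \<kappa>) \<le> lam * 1" using lam_pos \<kappa> by (intro mult_left_mono) auto
  then have le: "lam0 \<le> lam" using lam' by simp
  have feas: "infnorm (transpose X *v (y - X *v b)) \<le> lam"
    and opt: "\<And>b'. infnorm (transpose X *v (y - X *v b')) \<le> lam \<Longrightarrow> l1norm b \<le> l1norm b'"
    using sel unfolding dantzig_selector_def is_arg_min_def by (auto simp: not_less)
  have l1: "l1norm b \<le> l1norm b0" using opt[of b0] noise le y by simp
  have "transpose X *v (X *v h) = transpose X *v \<epsilon> + - (transpose X *v (y - X *v b))"
    by (simp add: h_def y matrix_vector_mult_diff_distrib matrix_vector_right_distrib)
  then have "infnorm (transpose X *v (X *v h)) \<le> lam + lam0"
    using infnorm_triangle[of "transpose X *v \<epsilon>" "- (transpose X *v (y - X *v b))"] feas noise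
    by (simp add: infnorm_neg)
  then have "h \<bullet> (transpose X *v (X *v h)) \<le> l1norm h * (lam + lam0)"
    using inner_le_l1norm_infnorm[of h] mult_left_mono[OF _ l1norm_nonneg[of h]] order_trans by blast
  moreover have "h \<bullet> (transpose X *v (X *v h)) = t\<^sup>2"
    by (simp add: t_def power2_norm_eq_inner inner_commute[of h] dot_lmul_matrix)
  ultimately have "t\<^sup>2 \<le> l1norm h * (lam + lam0)" by simp
  also have "\<dots> \<le> l1norm h * (2 * lam * (1 - 2 * \<kappa>))"
    using lam' by (intro mult_left_mono l1norm_nonneg) (simp add: algebra_simps)
  also have "\<dots> = 2 * lam * ((1 - 2 * \<kappa>) * l1norm h)" by simp
  also have "\<dots> \<le> 2 * lam * (2 * (a * t + B))"
  proof (rule mult_left_mono)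
    have "l1norm h \<le> 2 * l1norm (restrict_vec h S) + 2 * B"
      using l1norm_error_le[OF l1] by (simp add: h_def B_def)
    then show "(1 - 2 * \<kappa>) * l1norm h \<le> 2 * (a * t + B)"
      using dist by (simp add: h_def[symmetric] t_def algebra_simps)
  qed (use lam_pos in simp)
  finally have "t\<^sup>2 \<le> (4 * lam) * (a * t + B)" by (simp add: algebra_simps)
  from quadratic_bound[OF a B _ this] lam_pos show ?thesis
    by (simp add: t_def h_def B_def matrix_vector_mult_diff_distrib)
qed

section \<open>The smallest singular value\<close>

lemma quadratic_nonneg_imp_linear_zero:
  fixes b c :: real
  assumes "\<And>t. 0 \<le> 2 * t * b + t\<^sup>2 * c"
  shows "b = 0"
proof (rule ccontr)
  assume "b \<noteq> 0"
  define d where "d = \<bar>c\<bar> + 1"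
  have d: "0 < d" "c < 2 * d" by (auto simp: d_def)
  have "2 * (- b / d) * b + (- b / d)\<^sup>2 * c = (b / d)\<^sup>2 * (c - 2 * d)"
    using d by (simp add: field_simps power2_eq_square)
  also have "\<dots> < 0" using d \<open>b \<noteq> 0\<close> by (intro mult_pos_neg) auto
  finally show False using assms[of "- b / d"] by simp
qed

text \<open>
  Minimise \<open>norm (X *v v)\<close> over the unit vectors \<open>v\<close> of the row space. First-order optimality says
  that \<open>X\<^sup>T X v - m\<^sup>2 v\<close> is orthogonal to the row space; as it also belongs to the row space, it
  vanishes. Hence the minimum \<open>m\<close> is a singular value, and the least one is no larger.
\<close>

lemma smallest_singular_value_le:
  fixes X :: "real ^ 'p ^ 'n"
  assumes rk: "rank X = CARD('n)" and z: "z \<in> range (\<lambda>u. transpose X *v u)"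
  shows "smallest_singular_value X * norm z \<le> norm (X *v z)"
proof (cases "z = 0")
  case False
  define W where "W = range (\<lambda>u. transpose X *v u)"
  have W: "subspace W" unfolding W_def
    by (intro linear_subspace_image matrix_vector_mul_linear subspace_UNIV)
  define K where "K = sphere 0 1 \<inter> W"
  have normalize: "(1 / norm w) *\<^sub>R w \<in> K" if "w \<in> W" "w \<noteq> 0" for w
    using that W by (simp add: K_def subspace_scale)
  have "compact K" unfolding K_def
    by (intro compact_Int_closed closed_subspace W) simp
  moreover have "K \<noteq> {}" using normalize[of z] z False by (auto simp: W_def)
  moreover have "continuous_on K (\<lambda>v. norm (X *v v))"
    by (intro continuous_intros linear_continuous_on matrix_vector_mul_bounded_linear)
  ultimately obtain v where v: "v \<in> K"
    and mn: "\<And>w. w \<in> K \<Longrightarrow> norm (X *v v) \<le> norm (X *v w)"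
    using continuous_attains_inf[of K] by metis
  define m where "m = norm (X *v v)"
  have nv: "norm v = 1" and vW: "v \<in> W" using v by (auto simp: K_def)
  have ge: "m * norm w \<le> norm (X *v w)" if "w \<in> W" for w
  proof (cases "w = 0")
    case False
    have "m \<le> norm (X *v ((1 / norm w) *\<^sub>R w))"
      unfolding m_def by (intro mn normalize that False)
    also have "\<dots> = norm (X *v w) / norm w" by (simp add: matrix_vector_mult_scaleR)
    finally show ?thesis using False by (simp add: field_simps)
  qed simp
  have "X *v v \<noteq> 0"
  proof
    assume "X *v v = 0"
    moreover obtain u where "v = transpose X *v u" using vW by (auto simp: W_def)
    ultimately have "v \<bullet> v = 0" using transpose_inner[of X u v] by simp
    then show False using nv by simp
  qed
  then have m: "0 < m" by (simp add: m_def)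
  define g where "g = transpose X *v (X *v v) - m\<^sup>2 *\<^sub>R v"
  have gW: "g \<in> W" unfolding g_def
    using W vW by (intro subspace_diff subspace_scale) (auto simp: W_def)
  have "(X *v v) \<bullet> (X *v g) - m\<^sup>2 * (v \<bullet> g) = 0"
  proof (rule quadratic_nonneg_imp_linear_zero)
    fix t
    have "v + t *\<^sub>R g \<in> W" using W vW gW by (intro subspace_add subspace_scale)
    then have "(m * norm (v + t *\<^sub>R g))\<^sup>2 \<le> (norm (X *v (v + t *\<^sub>R g)))\<^sup>2"
      using ge m by (intro power_mono) auto
    then have "m\<^sup>2 * ((v + t *\<^sub>R g) \<bullet> (v + t *\<^sub>R g)) \<le>
        (X *v v + t *\<^sub>R (X *v g)) \<bullet> (X *v v + t *\<^sub>R (X *v g))"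
      by (simp add: power_mult_distrib power2_norm_eq_inner matrix_vector_right_distrib
          matrix_vector_mult_scaleR)
    moreover have "v \<bullet> v = 1" "(X *v v) \<bullet> (X *v v) = m\<^sup>2"
      using nv by (simp_all add: m_def power2_norm_eq_inner flip: norm_eq_1)
    ultimately show "0 \<le> 2 * t * ((X *v v) \<bullet> (X *v g) - m\<^sup>2 * (v \<bullet> g)) +
        t\<^sup>2 * ((X *v g) \<bullet> (X *v g) - m\<^sup>2 * (g \<bullet> g))"
      by (simp add: inner_add_left inner_add_right inner_commute
          algebra_simps power2_eq_square)
  qed
  moreover have "g \<bullet> g = (transpose X *v (X *v v) - m\<^sup>2 *\<^sub>R v) \<bullet> g"
    by (simp only: g_def)
  ultimately have "g \<bullet> g = 0" by (simp add: inner_diff_left dot_lmul_matrix)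
  then have g: "transpose X *v (X *v v) = m\<^sup>2 *\<^sub>R v" by (simp add: g_def)
  have "m \<in> singular_values X"
    unfolding singular_values_def
  proof (intro CollectI conjI exI[of _ "(1 / m) *\<^sub>R (X *v v)"] exI[of _ v])
    show "transpose X *v ((1 / m) *\<^sub>R (X *v v)) = m *\<^sub>R v"
      using g m by (simp add: matrix_vector_mult_scaleR power2_eq_square)
  qed (use m nv in \<open>simp_all add: m_def\<close>)
  then have "smallest_singular_value X \<le> m"
    unfolding smallest_singular_value_def
    using singular_values_full_row_rank(1)[OF rk] by (intro Min_le)
  then have "smallest_singular_value X * norm z \<le> m * norm z"
    by (intro mult_right_mono) auto
  also have "\<dots> \<le> norm (X *v z)" using ge z by (simp add: W_def)
  finally show ?thesis .
qed simp

lemma smallest_singular_value_pos: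
  fixes X :: "real ^ 'p ^ 'n"
  assumes "rank X = CARD('n)"
  shows "0 < smallest_singular_value X"
  using singular_values_full_row_rank[OF assms] Min_in unfolding smallest_singular_value_def by blast

section \<open>Kernels of bounded distortion\<close>

text \<open>The defining properties pass to the supremum, so the least admissible constant is admissible.\<close>

lemma
  fixes \<Gamma> :: "(real ^ 'p) set"
  assumes "subspace \<Gamma>"
  shows distortion_ge_1: "1 \<le> distortion \<Gamma>"
    and norm_le_distortion: "x \<in> \<Gamma> \<Longrightarrow> sqrt (CARD('p)) * norm x \<le> distortion \<Gamma> * l1norm x"
proof -
  let ?f = "\<lambda>x :: real ^ 'p. sqrt (CARD('p)) * norm x / l1norm x"
  have pos: "l1norm x > 0" if "x \<noteq> 0" for x :: "real ^ 'p"
    using norm_le_l1norm[of x] that by (meson less_le_trans zero_less_norm_iff)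
  have bdd: "bdd_above (?f ` (\<Gamma> - {0}))"
  proof (rule bdd_aboveI2)
    show "?f x \<le> sqrt (CARD('p))" if "x \<in> \<Gamma> - {0}" for x
      using norm_le_l1norm[of x] pos[of x] that by (simp add: field_simps)
  qed
  have up: "?f x \<le> distortion \<Gamma>" if "x \<in> \<Gamma>" "x \<noteq> 0" for x
  proof -
    have "\<Gamma> \<noteq> {0}" using that by auto
    then show ?thesis
      using distortion_eq_SUP[OF assms] cSUP_upper[OF _ bdd, of x] that by simp
  qed
  show "1 \<le> distortion \<Gamma>"
  proof (cases "\<Gamma> = {0}")
    case True
    then show ?thesis using distortion_eq_SUP[OF assms] by simp
  next
    case False
    then obtain x where x: "x \<in> \<Gamma>" "x \<noteq> 0" using subspace_0[OF assms] by blast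
    have "1 \<le> ?f x" using l1norm_le_norm[of x] pos[OF x(2)] by (simp add: field_simps)
    with up[OF x] show ?thesis by linarith
  qed
  show "sqrt (CARD('p)) * norm x \<le> distortion \<Gamma> * l1norm x" if "x \<in> \<Gamma>"
  proof (cases "x = 0")
    case False
    with up[OF that] pos[of x] show ?thesis by (simp add: field_simps)
  qed (simp add: l1norm_def)
qed

text \<open>
  With \<open>\<gamma> = x + z\<close>, \<open>x\<close> in the kernel and \<open>z\<close> in the row space, the kernel component satisfies
  \<open>norm x \<le> (\<delta> / sqrt p) * l1norm x\<close>, where \<open>l1norm x \<le> l1norm \<gamma> + sqrt p * norm z\<close>. So
  \<open>norm \<gamma> \<le> (\<delta> / sqrt p) * l1norm \<gamma> + (1 + \<delta>) * norm z\<close>, and it remains to multiply by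
  \<open>sqrt (card S) \<le> \<kappa> * sqrt p / \<delta>\<close> and to use \<open>1 + \<delta> \<le> 2 * \<delta>\<close>.
\<close>

lemma distortion_ineq_of_kernel_distortion:
  fixes X :: "real ^ 'p ^ 'n" and \<gamma> :: "real ^ 'p" and S :: "'p set"
  defines "\<delta> \<equiv> distortion {x. X *v x = 0}" and "\<rho> \<equiv> smallest_singular_value X"
  assumes rk: "rank X = CARD('n)" and \<kappa>: "0 < \<kappa>"
    and S: "real (card S) \<le> (\<kappa> / \<delta>)\<^sup>2 * CARD('p)"
  shows "l1norm (restrict_vec \<gamma> S) \<le>
    (2 * \<delta> / \<rho> * sqrt (card S)) * norm (X *v \<gamma>) + \<kappa> * l1norm \<gamma>"
proof -
  let ?P = "sqrt (CARD('p))" and ?s = "sqrt (card S)"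
  have ker: "subspace {x. X *v x = 0}"
    by (simp add: subspace_def matrix_vector_right_distrib matrix_vector_mult_scaleR)
  have \<delta>: "1 \<le> \<delta>" unfolding \<delta>_def by (rule distortion_ge_1[OF ker])
  have \<rho>: "0 < \<rho>" unfolding \<rho>_def by (rule smallest_singular_value_pos[OF rk])
  have P: "0 < ?P" by simp
  let ?W = "range (\<lambda>u. transpose X *v u)"
  have "subspace ?W"
    by (intro linear_subspace_image matrix_vector_mul_linear subspace_UNIV)
  then have span: "span ?W = ?W" by (simp add: span_eq_iff)
  obtain z x where z: "z \<in> ?W" and x: "\<And>w. w \<in> ?W \<Longrightarrow> orthogonal x w" and \<gamma>: "\<gamma> = z + x"
    using orthogonal_subspace_decomp_exists[of ?W \<gamma>] unfolding span by metis
  have "(X *v x) \<bullet> (X *v x) = 0"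
    using x[of "transpose X *v (X *v x)"] transpose_inner[of X "X *v x" x]
    by (simp add: orthogonal_def inner_commute)
  then have x0: "X *v x = 0" by simp
  have z_le: "norm z \<le> norm (X *v \<gamma>) / \<rho>"
    using smallest_singular_value_le[OF rk z] \<rho> x0
    by (simp add: \<rho>_def[symmetric] \<gamma> matrix_vector_right_distrib field_simps)
  have "l1norm x \<le> l1norm \<gamma> + l1norm z"
    using l1norm_diff_le[of \<gamma> z] by (simp add: \<gamma>)
  then have "l1norm x \<le> l1norm \<gamma> + ?P * norm z"
    using l1norm_le_norm[of z] by linarith
  then have "\<delta> * l1norm x \<le> \<delta> * (l1norm \<gamma> + ?P * norm z)"
    using \<delta> by (intro mult_left_mono) auto
  then have "?P * norm x \<le> \<delta> * (l1norm \<gamma> + ?P * norm z)"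
    using norm_le_distortion[OF ker, of x] x0 by (simp add: \<delta>_def)
  then have x_le: "norm x \<le> \<delta> / ?P * l1norm \<gamma> + \<delta> * norm z"
    using P by (simp add: field_simps)
  have "norm \<gamma> \<le> norm z + norm x" unfolding \<gamma> by (rule norm_triangle_ineq)
  moreover have "norm z \<le> \<delta> * norm z" using \<delta> by (simp add: mult_le_cancel_right1)
  ultimately have "norm \<gamma> \<le> \<delta> / ?P * l1norm \<gamma> + 2 * \<delta> * norm z"
    using x_le by linarith
  also have "\<dots> \<le> \<delta> / ?P * l1norm \<gamma> + 2 * \<delta> * (norm (X *v \<gamma>) / \<rho>)"
    using z_le \<delta> by (intro add_left_mono mult_left_mono) auto
  finally have \<gamma>_le: "norm \<gamma> \<le> \<delta> / ?P * l1norm \<gamma> + 2 * \<delta> * (norm (X *v \<gamma>) / \<rho>)" .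
  have "?s \<le> sqrt ((\<kappa> / \<delta>)\<^sup>2 * CARD('p))" using S by simp
  also have "\<dots> = \<kappa> / \<delta> * ?P" using \<kappa> \<delta> by (simp add: real_sqrt_mult)
  finally have "?s * (\<delta> / ?P) \<le> \<kappa>" using \<delta> P by (simp add: field_simps)
  then have small: "?s * (\<delta> / ?P) * l1norm \<gamma> \<le> \<kappa> * l1norm \<gamma>"
    by (intro mult_right_mono l1norm_nonneg)
  have "l1norm (restrict_vec \<gamma> S) \<le> ?s * norm \<gamma>" by (rule l1norm_restrict_vec_le)
  also have "\<dots> \<le> ?s * (\<delta> / ?P * l1norm \<gamma> + 2 * \<delta> * (norm (X *v \<gamma>) / \<rho>))"
    using \<gamma>_le by (intro mult_left_mono) auto
  also have "\<dots> = ?s * (\<delta> / ?P) * l1norm \<gamma> + (2 * \<delta> / \<rho> * ?s) * norm (X *v \<gamma>)"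
    by (simp add: algebra_simps)
  finally show ?thesis using small by linarith
qed

section \<open>The two bounds\<close>

theorem theorem2p4:
  fixes X :: "real ^ 'p ^ 'n"
    and \<beta>star :: "real ^ 'p"
    and \<epsilon> y :: "real ^ 'n"
    and lam0 :: real
  assumes "CARD('n) \<le> CARD('p)"
    and "rank X = CARD('n)"
    and "y = X *v \<beta>star + \<epsilon>"
    and "infnorm (transpose X *v \<epsilon>) \<le> lam0"
  shows
    "(\<forall>(S0 :: nat) (\<kappa>0 :: real) (\<Delta> :: real) (lamd :: real) (\<beta>d :: real ^ 'p).
        1 \<le> S0 \<and> S0 \<le> CARD('p) \<and> 0 < \<kappa>0 \<and> \<kappa>0 < 1/4 \<and> UDP X S0 \<kappa>0 \<Delta> \<and>
        0 < lamd \<and> lamd > lam0 / (1 - 4 * \<kappa>0) \<and> dantzig_selector X y lamd \<beta>d \<longrightarrow>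
        norm (X *v \<beta>d - X *v \<beta>star) \<le>
          (MIN S \<in> {S :: 'p set. 1 \<le> card S \<and> card S \<le> S0}.
             4 * lamd * \<Delta> * sqrt (card S) +
             l1norm (restrict_vec \<beta>star (- S)) / (\<Delta> * sqrt (card S))))
     \<and>
     (\<forall>(\<rho> :: real) (\<delta> :: real) (\<kappa>0 :: real) (lamd :: real) (\<beta>d :: real ^ 'p) (S :: 'p set) (s :: nat).
        \<rho> = smallest_singular_value X \<and> \<delta> = distortion {x. X *v x = 0} \<and>
        0 < \<kappa>0 \<and> \<kappa>0 < 1/4 \<and>
        0 < lamd \<and> lamd > lam0 / (1 - 4 * \<kappa>0) \<and> dantzig_selector X y lamd \<beta>d \<and>
        card S = s \<and> 1 \<le> s \<and> real s \<le> (\<kappa>0 / \<delta>)\<^sup>2 * CARD('p) \<longrightarrow>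
        norm (X *v \<beta>d - X *v \<beta>star) \<le>
          4 * lamd * (2 * \<delta> / \<rho>) * sqrt s +
          1 / (2 * \<delta> * sqrt s) * \<rho> * l1norm (restrict_vec \<beta>star (- S)))"
proof (rule conjI)
  show "\<forall>(S0 :: nat) (\<kappa>0 :: real) (\<Delta> :: real) (lamd :: real) (\<beta>d :: real ^ 'p).
        1 \<le> S0 \<and> S0 \<le> CARD('p) \<and> 0 < \<kappa>0 \<and> \<kappa>0 < 1/4 \<and> UDP X S0 \<kappa>0 \<Delta> \<and>
        0 < lamd \<and> lamd > lam0 / (1 - 4 * \<kappa>0) \<and> dantzig_selector X y lamd \<beta>d \<longrightarrow>
        norm (X *v \<beta>d - X *v \<beta>star) \<le>
          (MIN S \<in> {S :: 'p set. 1 \<le> card S \<and> card S \<le> S0}.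
             4 * lamd * \<Delta> * sqrt (card S) +
             l1norm (restrict_vec \<beta>star (- S)) / (\<Delta> * sqrt (card S)))"
  proof (intro allI impI, elim conjE)
    fix S0 :: nat and \<kappa>0 \<Delta> lamd :: real and \<beta>d :: "real ^ 'p"
    assume S0: "1 \<le> S0" and \<kappa>: "0 < \<kappa>0" "\<kappa>0 < 1/4" and udp: "UDP X S0 \<kappa>0 \<Delta>"
      and lam: "lam0 / (1 - 4 * \<kappa>0) < lamd" and sel: "dantzig_selector X y lamd \<beta>d"
    let ?A = "{S :: 'p set. 1 \<le> card S \<and> card S \<le> S0}"
    have "norm (X *v \<beta>d - X *v \<beta>star) \<le>
        4 * lamd * \<Delta> * sqrt (card S) + l1norm (restrict_vec \<beta>star (- S)) / (\<Delta> * sqrt (card S))"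
      if "S \<in> ?A" for S
    proof -
      have "0 < \<Delta> * sqrt (card S)" using that udp by (simp add: UDP_def)
      moreover have "l1norm (restrict_vec (\<beta>d - \<beta>star) S) \<le>
          \<Delta> * sqrt (card S) * norm (X *v (\<beta>d - \<beta>star)) + \<kappa>0 * l1norm (\<beta>d - \<beta>star)"
        using that udp by (simp add: UDP_def)
      ultimately show ?thesis
        using dantzig_prediction_bound[OF assms(3,4) \<kappa> lam sel] by (simp add: mult.assoc)
    qed
    moreover have "?A \<noteq> {}" using S0 by (auto intro!: exI[of _ "{undefined}"])
    ultimately show "norm (X *v \<beta>d - X *v \<beta>star) \<le>
        (MIN S \<in> ?A. 4 * lamd * \<Delta> * sqrt (card S) +
           l1norm (restrict_vec \<beta>star (- S)) / (\<Delta> * sqrt (card S)))"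
      by (subst Min_ge_iff) simp_all
  qed
next
  show "\<forall>(\<rho> :: real) (\<delta> :: real) (\<kappa>0 :: real) (lamd :: real) (\<beta>d :: real ^ 'p) (S :: 'p set) (s :: nat).
        \<rho> = smallest_singular_value X \<and> \<delta> = distortion {x. X *v x = 0} \<and>
        0 < \<kappa>0 \<and> \<kappa>0 < 1/4 \<and>
        0 < lamd \<and> lamd > lam0 / (1 - 4 * \<kappa>0) \<and> dantzig_selector X y lamd \<beta>d \<and>
        card S = s \<and> 1 \<le> s \<and> real s \<le> (\<kappa>0 / \<delta>)\<^sup>2 * CARD('p) \<longrightarrow>
        norm (X *v \<beta>d - X *v \<beta>star) \<le>
          4 * lamd * (2 * \<delta> / \<rho>) * sqrt s +
          1 / (2 * \<delta> * sqrt s) * \<rho> * l1norm (restrict_vec \<beta>star (- S))"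
  proof (intro allI impI, elim conjE)
    fix \<rho> \<delta> \<kappa>0 lamd :: real and \<beta>d :: "real ^ 'p" and S :: "'p set" and s :: nat
    assume \<rho>: "\<rho> = smallest_singular_value X" and \<delta>: "\<delta> = distortion {x. X *v x = 0}"
      and \<kappa>: "0 < \<kappa>0" "\<kappa>0 < 1/4" and lam: "lam0 / (1 - 4 * \<kappa>0) < lamd"
      and sel: "dantzig_selector X y lamd \<beta>d"
      and s: "card S = s" "1 \<le> s" "real s \<le> (\<kappa>0 / \<delta>)\<^sup>2 * CARD('p)"
    have "subspace {x. X *v x = 0}"
      by (simp add: subspace_def matrix_vector_right_distrib matrix_vector_mult_scaleR)
    then have "1 \<le> \<delta>" unfolding \<delta> by (rule distortion_ge_1)
    moreover have "0 < \<rho>" unfolding \<rho> by (rule smallest_singular_value_pos[OF assms(2)])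
    ultimately have "0 < 2 * \<delta> / \<rho> * sqrt s" using s by simp
    moreover have "l1norm (restrict_vec (\<beta>d - \<beta>star) S) \<le>
        (2 * \<delta> / \<rho> * sqrt s) * norm (X *v (\<beta>d - \<beta>star)) + \<kappa>0 * l1norm (\<beta>d - \<beta>star)"
      using distortion_ineq_of_kernel_distortion[OF assms(2) \<kappa>(1), of S "\<beta>d - \<beta>star"] s
      by (simp add: \<rho> \<delta>)
    ultimately have "norm (X *v \<beta>d - X *v \<beta>star) \<le> 4 * lamd * (2 * \<delta> / \<rho> * sqrt s) +
        l1norm (restrict_vec \<beta>star (- S)) / (2 * \<delta> / \<rho> * sqrt s)"
      by (rule dantzig_prediction_bound[OF assms(3,4) \<kappa> lam sel])
    also have "\<dots> = 4 * lamd * (2 * \<delta> / \<rho>) * sqrt s +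
        1 / (2 * \<delta> * sqrt s) * \<rho> * l1norm (restrict_vec \<beta>star (- S))"
      by (simp add: mult_ac)
    finally show "norm (X *v \<beta>d - X *v \<beta>star) \<le> 4 * lamd * (2 * \<delta> / \<rho>) * sqrt s +
        1 / (2 * \<delta> * sqrt s) * \<rho> * l1norm (restrict_vec \<beta>star (- S))" .
  qed
qed

end
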